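(* Let $k,\rho,c,\lambda,\Theta_\infty,h>0$ be constants and set $\alpha=\frac{k}{\rho c}$, $\mathrm{Ste}=\frac{c\Theta_\infty}{\lambda}$, $\mathrm{Bi}=\frac{h\sqrt{\alpha}}{k}$. Then the polynomial equation $$\frac{1}{\mathrm{Bi}}z^{3}+(6+\mathrm{Ste})z^{2}+\frac{3}{\mathrm{Bi}}z-3\mathrm{Ste}=0$$ has exactly one solution $z=\xi_3$ in the interval $0<z<\sqrt{3}$; the constants $$A_{3}=\frac{2\xi_{3}(3-\xi_3^{2})}{\frac{1}{\mathrm{Bi}}\xi_{3}^{2}+6\xi_{3}+\frac{3}{\mathrm{Bi}}},\qquad B_{3}=\frac{2\xi_{3}^{3}}{\frac{1}{\mathrm{Bi}}\xi_{3}^{2}+6\xi_{3}+\frac{3}{\mathrm{Bi}}}$$ are positive; and the (unique) solution of Problem (P3) for a quadratic profile in space is $$T_{3}(x,t)=-A_{3}\Theta_{\infty}\left(1-\frac{x}{s_{3}(t)}\right)-B_{3}\Theta_{\infty}\left(1-\frac{x}{s_{3}(t)}\right)^{2},\qquad s_{3}(t)=2\xi_{3}\sqrt{\alpha t}.$$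
   Context: Problem (P3): find $s_3=s_3(t)$ and $T_3=T_3(x,t)$, defined for $0\le x\le s_3(t)$, $t>0$, such that - $\displaystyle\int_0^{s_{3}(t)}\int_0^x\frac{\partial T_3}{\partial t}(\eta,t)\,d\eta\,dx=-\dfrac{k}{\rho c}\left[T_{3}(0,t)+\dfrac{\partial T_3}{\partial x}(0,t)\,s_{3}(t)\right]$, $t>0$; - $k\dfrac{\partial T_3}{\partial x}(0,t)=\dfrac{h}{\sqrt{t}}\left(T_{3}(0,t)+\Theta_{\infty}\right)$, $t>0$; - $T_{3}(s_{3}(t),t)=0$, $t>0$; - $k\dfrac{\partial T_3}{\partial x}(s_{3}(t),t)=\rho\lambda\dot{s}_{3}(t)$, $t>0$; - $s_{3}(0)=0$. A solution "for a quadratic profile in space" is a solution pair $(T_3,s_3)$ in which $T_3(x,t)=-A\Theta_\infty\left(1-\frac{x}{s_3(t)}\right)-B\Theta_\infty\left(1-\frac{x}{s_3(t)}\right)^2$ for some constants $A>0$, $B>0$, with $s_3$ continuous on $[0,\infty)$, continuously differentiable and positive on $(0,\infty)$. *)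

theory Defs
  imports "HOL-Analysis.Analysis"
begin

text \<open>
  Problem (P3) for a temperature \<open>T\<close> (arguments: position, then time) and a free boundary \<open>s\<close>.
  Only the values of \<open>T x t\<close> with \<open>0 \<le> x \<le> s t\<close>, \<open>t > 0\<close>, and of \<open>s t\<close> with \<open>t \<ge> 0\<close> are
  meaningful, so the partial derivatives \<open>Tx\<close> and \<open>Tt\<close> are taken within this domain: they are
  one-sided where a point lies on its boundary. The constants are the conductivity \<open>k\<close>, the
  density \<open>\<rho>\<close>, the specific heat \<open>c\<close>, the latent heat \<open>L\<close> (usually written lambda), the bulk
  temperature parameter \<open>\<Theta>\<close> and the heat transfer coefficient \<open>h\<close>.
  The iterated integral is required to exist, since \<open>integral\<close> is \<open>0\<close> for non-integrable functions.
\<close>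

definition P3_solution ::
  "real \<Rightarrow> real \<Rightarrow> real \<Rightarrow> real \<Rightarrow> real \<Rightarrow> real \<Rightarrow> (real \<Rightarrow> real \<Rightarrow> real) \<Rightarrow> (real \<Rightarrow> real) \<Rightarrow> bool"
where
  "P3_solution k \<rho> c L \<Theta> h T s \<longleftrightarrow>
    (\<exists>Tx Tt :: real \<Rightarrow> real \<Rightarrow> real.
      (\<forall>t>0. \<forall>x\<in>{0..s t}.
         ((\<lambda>y. T y t) has_real_derivative Tx x t) (at x within {0..s t})) \<and>
      (\<forall>t>0. \<forall>x\<in>{0..s t}.
         ((\<lambda>\<tau>. T x \<tau>) has_real_derivative Tt x t) (at t within {\<tau>. 0 < \<tau> \<and> x \<le> s \<tau>})) \<and>
      (\<forall>t>0. s differentiable (at t)) \<and>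
      (\<forall>t>0. (\<forall>x\<in>{0..s t}. (\<lambda>\<eta>. Tt \<eta> t) integrable_on {0..x}) \<and>
         ((\<lambda>x. integral {0..x} (\<lambda>\<eta>. Tt \<eta> t)) has_integral
            - (k / (\<rho> * c)) * (T 0 t + Tx 0 t * s t)) {0..s t}) \<and>
      (\<forall>t>0. k * Tx 0 t = h / sqrt t * (T 0 t + \<Theta>)) \<and>
      (\<forall>t>0. T (s t) t = 0) \<and>
      (\<forall>t>0. k * Tx (s t) t = \<rho> * L * deriv s t) \<and>
      s 0 = 0)"

definition quadratic_profile ::
  "real \<Rightarrow> real \<Rightarrow> real \<Rightarrow> (real \<Rightarrow> real) \<Rightarrow> real \<Rightarrow> real \<Rightarrow> real"
where
  "quadratic_profile \<Theta> A B s x t =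
     - A * \<Theta> * (1 - x / s t) - B * \<Theta> * (1 - x / s t)\<^sup>2"

definition P3_quadratic_solution ::
  "real \<Rightarrow> real \<Rightarrow> real \<Rightarrow> real \<Rightarrow> real \<Rightarrow> real \<Rightarrow> (real \<Rightarrow> real \<Rightarrow> real) \<Rightarrow> (real \<Rightarrow> real) \<Rightarrow> bool"
where
  "P3_quadratic_solution k \<rho> c L \<Theta> h T s \<longleftrightarrow>
     P3_solution k \<rho> c L \<Theta> h T s \<and>
     continuous_on {0..} s \<and>
     (\<forall>t>0. s differentiable (at t)) \<and> continuous_on {0<..} (deriv s) \<and>
     (\<forall>t>0. 0 < s t) \<and>
     (\<exists>A>0. \<exists>B>0. \<forall>t>0. \<forall>x\<in>{0..s t}. T x t = quadratic_profile \<Theta> A B s x t)"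

end

theory Submission
  imports Defs
begin

text \<open>
  For a quadratic profile with coefficients \<open>A\<close>, \<open>B\<close> the integrated heat equation, the Robin
  condition and the Stefan condition become \<open>s s' (A + B) = 6 \<alpha> B\<close>,
  \<open>k (A + 2B) sqrt t = h s (1 - A - B)\<close> and \<open>s s' = \<alpha> Ste A\<close>. The last one makes
  \<open>s\<^sup>2\<close> linear in time, so \<open>s = 2 z sqrt (\<alpha> t)\<close> with \<open>2 z\<^sup>2 = Ste A\<close>. The first then reads
  \<open>z\<^sup>2 (A + B) = 3 B\<close>, forcing \<open>z < sqrt 3\<close>, and solving the first two for \<open>A\<close>, \<open>B\<close> and
  substituting into \<open>2 z\<^sup>2 = Ste A\<close> gives the cubic, whose left-hand side increases for \<open>z > 0\<close>.
\<close>

section \<open>Derivatives and integrals of the quadratic profile\<close>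

lemma has_real_derivative_quadratic_profile_space:
  assumes "s t \<noteq> 0"
  shows "((\<lambda>y. quadratic_profile \<Theta> A B s y t) has_real_derivative
     A * \<Theta> / s t + 2 * B * \<Theta> * (1 - x / s t) / s t) (at x within S)"
  unfolding quadratic_profile_def using assms
  by (auto intro!: derivative_eq_intros)

lemma has_real_derivative_quadratic_profile_time:
  assumes "(s has_real_derivative d) (at t)" "s t \<noteq> 0"
  shows "((\<lambda>\<tau>. quadratic_profile \<Theta> A B s x \<tau>) has_real_derivative
     - (\<Theta> * d / (s t)\<^sup>2) * (A * x + 2 * B * (1 - x / s t) * x)) (at t within S)"
proof -
  have "(s has_real_derivative d) (at t within S)"
    using assms(1) by (rule has_field_derivative_at_within)
  then show ?thesis
    unfolding quadratic_profile_def using assms(2)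
    by (auto intro!: derivative_eq_intros simp: field_simps power2_eq_square)
qed

text \<open>The bracket is an antiderivative vanishing at \<open>0\<close>. The value of
  \<open>g\<close> at the endpoint \<open>a\<close> is left free because the time derivative may be
  undetermined on the free boundary; one point is negligible.\<close>

lemma has_integral_quadratic_profile_time_derivative:
  fixes a :: real
  assumes "0 < a" "0 \<le> x" "x \<le> a"
    and "\<And>\<eta>. 0 \<le> \<eta> \<Longrightarrow> \<eta> < a \<Longrightarrow> g \<eta> = - m * (A * \<eta> + 2 * B * (1 - \<eta> / a) * \<eta>)"
  shows "(g has_integral - m * (A * x\<^sup>2 / 2 + B * x\<^sup>2 - 2 * B * x ^ 3 / (3 * a))) {0..x}"
proof -
  have "((\<lambda>\<eta>. - m * (A * \<eta> + 2 * B * (1 - \<eta> / a) * \<eta>)) has_integral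
     (- m * (A * x\<^sup>2 / 2 + B * x\<^sup>2 - 2 * B * x ^ 3 / (3 * a))
      - (- m * (A * 0\<^sup>2 / 2 + B * 0\<^sup>2 - 2 * B * 0 ^ 3 / (3 * a))))) {0..x}"
    using assms(1,2)
    by (intro fundamental_theorem_of_calculus)
       (auto intro!: derivative_eq_intros
         simp flip: has_real_derivative_iff_has_vector_derivative
         simp: field_simps power2_eq_square)
  then have "((\<lambda>\<eta>. - m * (A * \<eta> + 2 * B * (1 - \<eta> / a) * \<eta>)) has_integral
     - m * (A * x\<^sup>2 / 2 + B * x\<^sup>2 - 2 * B * x ^ 3 / (3 * a))) {0..x}"
    by simp
  then show ?thesis
    by (rule has_integral_spike_finite[of "{a}", rotated 2]) (use assms in auto)
qed

text \<open>A second integration gives \<open>A / 6 + B / 3 - B / 6 = (A + B) / 6\<close> times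
  \<open>a ^ 3\<close>. With \<open>a = s t\<close> and \<open>m\<close> equal to \<Theta> times
  \<open>deriv s t / (s t)\<^sup>2\<close>, the powers of \<open>s t\<close> reduce to the product
  \<open>s t * deriv s t\<close>.\<close>

lemma has_integral_integral_quadratic_profile_time_derivative:
  fixes a :: real
  assumes "0 < a"
    and "\<And>\<eta>. 0 \<le> \<eta> \<Longrightarrow> \<eta> < a \<Longrightarrow> g \<eta> = - m * (A * \<eta> + 2 * B * (1 - \<eta> / a) * \<eta>)"
  shows "((\<lambda>x. integral {0..x} g) has_integral - m * a ^ 3 * (A + B) / 6) {0..a}"
proof -
  have "((\<lambda>x. - m * (A * x\<^sup>2 / 2 + B * x\<^sup>2 - 2 * B * x ^ 3 / (3 * a))) has_integral
     (- m * (A * a ^ 3 / 6 + B * a ^ 3 / 3 - B * a ^ 4 / (6 * a))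
      - (- m * (A * 0 ^ 3 / 6 + B * 0 ^ 3 / 3 - B * 0 ^ 4 / (6 * a))))) {0..a}"
    using assms(1)
    by (intro fundamental_theorem_of_calculus)
       (auto intro!: derivative_eq_intros
         simp flip: has_real_derivative_iff_has_vector_derivative
         simp: field_simps power2_eq_square power3_eq_cube)
  also have "- m * (A * a ^ 3 / 6 + B * a ^ 3 / 3 - B * a ^ 4 / (6 * a))
      - (- m * (A * 0 ^ 3 / 6 + B * 0 ^ 3 / 3 - B * 0 ^ 4 / (6 * a))) = - m * a ^ 3 * (A + B) / 6"
    using assms(1) by (simp add: field_simps power3_eq_cube power4_eq_xxxx)
  finally show ?thesis
    using has_integral_quadratic_profile_time_derivative[OF assms(1) _ _ assms(2), THEN integral_unique]
    by (subst has_integral_cong[where g = "\<lambda>x. - m * (A * x\<^sup>2 / 2 + B * x\<^sup>2 - 2 * B * x ^ 3 / (3 * a))"])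
       (auto simp: assms)
qed

section \<open>Problem (P3) as equations for the coefficients and the boundary\<close>

text \<open>The profile vanishes identically at \<open>x = s t\<close>, so what remains is the
  initial condition and, in this order, the heat balance, the Robin condition and the Stefan
  condition.\<close>

lemma P3_solution_quadratic_profile_iff:
  assumes pos: "\<And>t. t > 0 \<Longrightarrow> 0 < s t"
    and diff: "\<And>t. t > 0 \<Longrightarrow> s differentiable (at t)"
    and T: "\<And>t x. t > 0 \<Longrightarrow> x \<in> {0..s t} \<Longrightarrow> T x t = quadratic_profile \<Theta> A B s x t"
  shows "P3_solution k \<rho> c L \<Theta> h T s \<longleftrightarrow> s 0 = 0 \<and>
    (\<forall>t>0. \<Theta> * (s t * deriv s t) * (A + B) / 6 = k / (\<rho> * c) * (B * \<Theta>) \<and>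
           k * ((A + 2 * B) * \<Theta> / s t) = h / sqrt t * (\<Theta> - (A + B) * \<Theta>) \<and>
           k * (A * \<Theta> / s t) = \<rho> * L * deriv s t)"
    (is "_ \<longleftrightarrow> _ \<and> (\<forall>t>0. ?eqs t)")
proof -
  \<comment> \<open>The explicit derivatives of the profile: witnesses for \<open>Tx\<close> and
    \<open>Tt\<close> in one direction, and in the other what any given \<open>Tx\<close> and
    \<open>Tt\<close> are compared with.\<close>
  define dx where "dx x t = A * \<Theta> / s t + 2 * B * \<Theta> * (1 - x / s t) / s t" for x t
  define m where "m t = \<Theta> * deriv s t / (s t)\<^sup>2" for t
  define dt where "dt x t = - m t * (A * x + 2 * B * (1 - x / s t) * x)" for x t
  have deriv_s: "(s has_real_derivative deriv s t) (at t)" if "t > 0" for t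
    using diff[OF that] by (simp add: DERIV_deriv_iff_real_differentiable)
  \<comment> \<open>\<open>T\<close> agrees with the profile only on the physical domain; this
    suffices because the derivatives are taken within that domain.\<close>
  have dx: "((\<lambda>y. T y t) has_real_derivative dx x t) (at x within {0..s t})"
    if "t > 0" "x \<in> {0..s t}" for x t
    unfolding dx_def
    by (rule has_field_derivative_transform_within
          [OF has_real_derivative_quadratic_profile_space zero_less_one])
       (use that T pos[of t] in auto)
  have dt: "((\<lambda>\<tau>. T x \<tau>) has_real_derivative dt x t) (at t within {\<tau>. 0 < \<tau> \<and> x \<le> s \<tau>})"
    if "t > 0" "x \<in> {0..s t}" for x t
    unfolding dt_def m_def
    by (rule has_field_derivative_transform_within
          [OF has_real_derivative_quadratic_profile_time zero_less_one])
       (use that T deriv_s pos[of t] in auto)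
  \<comment> \<open>Stated for any \<open>f\<close> that matches \<open>dt\<close> below
    \<open>s t\<close>, so as to cover both \<open>dt\<close> itself and an arbitrary admissible
    \<open>Tt\<close>.\<close>
  have inner: "(\<lambda>\<eta>. f \<eta>) integrable_on {0..x}"
    and outer: "((\<lambda>x. integral {0..x} (\<lambda>\<eta>. f \<eta>)) has_integral
        - (\<Theta> * (s t * deriv s t) * (A + B) / 6)) {0..s t}"
    if "t > 0" "x \<in> {0..s t}" and f: "\<And>\<eta>. 0 \<le> \<eta> \<Longrightarrow> \<eta> < s t \<Longrightarrow> f \<eta> = dt \<eta> t" for f x t
  proof -
    show "(\<lambda>\<eta>. f \<eta>) integrable_on {0..x}"
      using has_integral_quadratic_profile_time_derivative[OF pos _ _ f[unfolded dt_def]] that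
      by (auto intro: has_integral_integrable)
    show "((\<lambda>x. integral {0..x} (\<lambda>\<eta>. f \<eta>)) has_integral
        - (\<Theta> * (s t * deriv s t) * (A + B) / 6)) {0..s t}"
    proof -
      have "- m t * s t ^ 3 * (A + B) / 6 = - (\<Theta> * (s t * deriv s t) * (A + B) / 6)"
        using pos[OF that(1)] by (simp add: m_def power2_eq_square power3_eq_cube)
      then show ?thesis
        using has_integral_integral_quadratic_profile_time_derivative
                [OF pos[OF that(1)] f[unfolded dt_def]] by metis
    qed
  qed
  have T0: "T 0 t = - ((A + B) * \<Theta>)" if "t > 0" for t
    using T[of t 0] pos[of t] that by (simp add: quadratic_profile_def algebra_simps)
  have Ts: "T (s t) t = 0" if "t > 0" for t
    using T[of t "s t"] pos[of t] that by (simp add: quadratic_profile_def)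
  have dx0: "dx 0 t = (A + 2 * B) * \<Theta> / s t" for t
    by (simp add: dx_def add_divide_distrib algebra_simps)
  have dxs: "dx (s t) t = A * \<Theta> / s t" if "t > 0" for t
    using pos[of t] that by (simp add: dx_def)
  have rhs: "- (k / (\<rho> * c)) * (T 0 t + dx 0 t * s t) = - (k / (\<rho> * c) * (B * \<Theta>))"
    if "t > 0" for t
  proof -
    have "dx 0 t * s t = (A + 2 * B) * \<Theta>"
      using pos[OF that] by (simp add: dx0)
    then show ?thesis
      by (simp add: T0[OF that] algebra_simps)
  qed
  show ?thesis
  proof
    assume "P3_solution k \<rho> c L \<Theta> h T s"
    then obtain Tx Tt where
      Tx: "\<forall>t>0. \<forall>x\<in>{0..s t}.
         ((\<lambda>y. T y t) has_real_derivative Tx x t) (at x within {0..s t})" and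
      Tt: "\<forall>t>0. \<forall>x\<in>{0..s t}.
         ((\<lambda>\<tau>. T x \<tau>) has_real_derivative Tt x t) (at t within {\<tau>. 0 < \<tau> \<and> x \<le> s \<tau>})" and
      heat: "\<forall>t>0. (\<forall>x\<in>{0..s t}. (\<lambda>\<eta>. Tt \<eta> t) integrable_on {0..x}) \<and>
         ((\<lambda>x. integral {0..x} (\<lambda>\<eta>. Tt \<eta> t)) has_integral
            - (k / (\<rho> * c)) * (T 0 t + Tx 0 t * s t)) {0..s t}" and
      robin: "\<forall>t>0. k * Tx 0 t = h / sqrt t * (T 0 t + \<Theta>)" and
      stefan: "\<forall>t>0. k * Tx (s t) t = \<rho> * L * deriv s t" and s0: "s 0 = 0"
      unfolding P3_solution_def by (elim exE conjE) (rule that)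
    note Tx = Tx[rule_format] and Tt = Tt[rule_format]
      and heat = heat[rule_format, THEN conjunct2]
      and robin = robin[rule_format] and stefan = stefan[rule_format]
    \<comment> \<open>Since \<open>s t > 0\<close>, the interval is nondegenerate and has no
      isolated point, so the derivative within it is unique, also at the ends.\<close>
    have Tx_eq: "Tx x t = dx x t" if "t > 0" "x \<in> {0..s t}" for x t
      using pos[OF that(1)] that(2)
      by (intro has_field_derivative_unique[OF Tx[OF that] dx[OF that]])
         (simp add: trivial_limit_within)
    text \<open>At \<open>x = s t\<close> the time \<open>t\<close> could be isolated in the domain of \<open>T x\<close>, but a single
      point does not affect the integrals.\<close>
    have Tt_eq: "Tt x t = dt x t" if "t > 0" "0 \<le> x" "x < s t" for x t
    proof -
      have "isCont s t"
        using deriv_s[OF that(1)] by (rule DERIV_isCont)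
      then have "\<forall>\<^sub>F \<tau> in nhds t. x < s \<tau>"
        unfolding isCont_def tendsto_at_iff_tendsto_nhds using that(3) by (rule order_tendstoD)
      moreover have "\<forall>\<^sub>F \<tau> in nhds t. 0 < \<tau>"
        using filterlim_ident that(1) by (rule order_tendstoD)
      ultimately have "\<forall>\<^sub>F \<tau> in nhds t. \<tau> \<in> {\<tau>. 0 < \<tau> \<and> x \<le> s \<tau>}"
        by eventually_elim auto
      then have "t \<in> interior {\<tau>. 0 < \<tau> \<and> x \<le> s \<tau>}"
        unfolding eventually_nhds by (auto intro!: interiorI)
      then have "at t within {\<tau>. 0 < \<tau> \<and> x \<le> s \<tau>} = at t"
        by (rule at_within_interior)
      then show ?thesis
        using Tt[of t x] dt[of t x] that DERIV_unique by auto
    qed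
    have "?eqs t" if t: "t > 0" for t
    proof (intro conjI)
      have end0: "0 \<in> {0..s t}" and ends: "s t \<in> {0..s t}"
        using pos[OF t] by auto
      show "\<Theta> * (s t * deriv s t) * (A + B) / 6 = k / (\<rho> * c) * (B * \<Theta>)"
        using has_integral_unique[OF outer[OF t end0 Tt_eq[OF t]] heat[OF t]]
        unfolding Tx_eq[OF t end0] rhs[OF t] by simp
      show "k * ((A + 2 * B) * \<Theta> / s t) = h / sqrt t * (\<Theta> - (A + B) * \<Theta>)"
        using robin[OF t] unfolding Tx_eq[OF t end0] T0[OF t] dx0 by simp
      show "k * (A * \<Theta> / s t) = \<rho> * L * deriv s t"
        using stefan[OF t] unfolding Tx_eq[OF t ends] dxs[OF t] .
    qed
    with s0 show "s 0 = 0 \<and> (\<forall>t>0. ?eqs t)" by blast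
  next
    assume eqs: "s 0 = 0 \<and> (\<forall>t>0. ?eqs t)"
    show "P3_solution k \<rho> c L \<Theta> h T s"
      unfolding P3_solution_def
    proof (rule exI[of _ dx], rule exI[of _ dt], intro conjI allI impI ballI)
      fix t :: real assume t: "t > 0"
      show "((\<lambda>x. integral {0..x} (\<lambda>\<eta>. dt \<eta> t)) has_integral
          - (k / (\<rho> * c)) * (T 0 t + dx 0 t * s t)) {0..s t}"
        using outer[OF t, of 0 "\<lambda>\<eta>. dt \<eta> t"] pos[OF t] eqs t unfolding rhs[OF t] by simp
      show "k * dx 0 t = h / sqrt t * (T 0 t + \<Theta>)"
        using eqs t unfolding dx0 T0[OF t] by simp
      show "k * dx (s t) t = \<rho> * L * deriv s t"
        using eqs t unfolding dxs[OF t] by simp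
    qed (use eqs dx dt diff Ts inner in auto)
  qed
qed

section \<open>The cubic equation and the coefficients\<close>

text \<open>The cubic changes sign: it is \<open>- 3 * S\<close> at \<open>0\<close>, and at
  \<open>sqrt 3\<close> the terms in \<open>S\<close> cancel and leave
  \<open>6 * b * sqrt 3 + 18\<close>. Positive coefficients in front of the powers of
  \<open>z\<close> make it strictly increasing for \<open>z > 0\<close>.\<close>

lemma ex1_root_cubic:
  fixes b S :: real
  assumes "b > 0" "S > 0"
  shows "\<exists>!z. 0 < z \<and> z < sqrt 3 \<and> b * z ^ 3 + (6 + S) * z\<^sup>2 + 3 * b * z - 3 * S = 0"
proof -
  let ?p = "\<lambda>z. b * z ^ 3 + (6 + S) * z\<^sup>2 + 3 * b * z - 3 * S"
  have mono: "?p x < ?p y" if "0 < x" "x < y" for x y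
  proof -
    have "x ^ 3 < y ^ 3" "x\<^sup>2 < y\<^sup>2"
      using that by (auto intro: power_strict_mono)
    then have "b * x ^ 3 < b * y ^ 3" "(6 + S) * x\<^sup>2 < (6 + S) * y\<^sup>2" "3 * b * x < 3 * b * y"
      using assms that by auto
    then show ?thesis by linarith
  qed
  have p0: "?p 0 < 0" using assms by simp
  have p3: "?p (sqrt 3) > 0"
    using assms by (simp add: algebra_simps add_pos_pos)
  have "\<exists>z\<ge>0. z \<le> sqrt 3 \<and> ?p z = 0"
    by (rule IVT') (use p0 p3 in \<open>auto intro!: continuous_intros\<close>)
  then obtain z where "0 \<le> z" "z \<le> sqrt 3" "?p z = 0" by blast
  moreover from this p0 p3 have "z \<noteq> 0" "z \<noteq> sqrt 3" by auto
  ultimately show ?thesis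
    using mono by (intro ex1I[of _ z]) (force, metis less_irrefl less_le linorder_less_linear)
qed

text \<open>Here \<open>b\<close> stands for \<open>1 / Bi\<close> and \<open>S\<close> for the Stefan number.\<close>

lemma quadratic_coefficients_satisfy:
  fixes z b S :: real
  assumes "0 < z" "z < sqrt 3" "b > 0" "S > 0"
    and root: "b * z ^ 3 + (6 + S) * z\<^sup>2 + 3 * b * z - 3 * S = 0"
  defines "A \<equiv> 2 * z * (3 - z\<^sup>2) / (b * z\<^sup>2 + 6 * z + 3 * b)"
    and "B \<equiv> 2 * z ^ 3 / (b * z\<^sup>2 + 6 * z + 3 * b)"
  shows "0 < A" "0 < B" "z\<^sup>2 * (A + B) = 3 * B" "b * (A + 2 * B) = 2 * z * (1 - A - B)"
    "2 * z\<^sup>2 = S * A"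
proof -
  define D where "D = b * z\<^sup>2 + 6 * z + 3 * b"
  have D: "D > 0" unfolding D_def using assms by (intro add_pos_pos mult_pos_pos) auto
  have "z\<^sup>2 < 3" using assms(1,2) by (metis less_le real_less_rsqrt not_le real_sqrt_le_iff real_sqrt_unique)
  then show "0 < A" "0 < B" unfolding A_def B_def D_def[symmetric] using D assms by auto
  have AD: "A * D = 2 * z * (3 - z\<^sup>2)" and BD: "B * D = 2 * z ^ 3"
    unfolding A_def B_def D_def[symmetric] using D by auto
  \<comment> \<open>Multiplying by the common denominator \<open>D > 0\<close> turns each claim into
    a polynomial identity.\<close>
  have "z\<^sup>2 * (A + B) * D = 3 * B * D"
    using AD BD by algebra
  then show "z\<^sup>2 * (A + B) = 3 * B" using D by simp
  have "b * (A + 2 * B) * D = 2 * z * (1 - A - B) * D"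
    using AD BD D_def by algebra
  then show "b * (A + 2 * B) = 2 * z * (1 - A - B)" using D by simp
  \<comment> \<open>Here the cubic enters: it says \<open>z * D = S * (3 - z\<^sup>2)\<close>, and
    \<open>2 * z\<close> times this is the claim.\<close>
  have "2 * z\<^sup>2 * D = S * A * D"
    using AD D_def root by algebra
  then show "2 * z\<^sup>2 = S * A" using D by simp
qed

text \<open>For given \<open>z\<close>, the heat and Robin equations are linear in \<open>A\<close>
  and \<open>B\<close>, with determinant \<open>b * z\<^sup>2 + 6 * z + 3 * b > 0\<close>; Cramer's
  rule gives the two quotients. The Stefan equation then yields the cubic.\<close>

lemma quadratic_coefficients_unique:
  fixes z b S A B :: real
  assumes pos: "0 < z" "b > 0" "0 < A" "0 < B"
    and heat: "z\<^sup>2 * (A + B) = 3 * B" and robin: "b * (A + 2 * B) = 2 * z * (1 - A - B)"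
    and stefan: "2 * z\<^sup>2 = S * A"
  shows "z < sqrt 3" "b * z ^ 3 + (6 + S) * z\<^sup>2 + 3 * b * z - 3 * S = 0"
    "A = 2 * z * (3 - z\<^sup>2) / (b * z\<^sup>2 + 6 * z + 3 * b)"
    "B = 2 * z ^ 3 / (b * z\<^sup>2 + 6 * z + 3 * b)"
proof -
  define D where "D = b * z\<^sup>2 + 6 * z + 3 * b"
  have D: "D > 0" unfolding D_def using assms by (intro add_pos_pos mult_pos_pos) auto
  \<comment> \<open>Positivity of \<open>A\<close> gives \<open>3 * B < 3 * (A + B)\<close>.\<close>
  have "z\<^sup>2 * (A + B) < 3 * (A + B)"
    using heat pos by simp
  then have "z\<^sup>2 < 3" by (rule mult_right_less_imp_less) (use pos in simp)
  then show "z < sqrt 3" by (rule real_less_rsqrt)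
  have AD: "A * D = 2 * z * (3 - z\<^sup>2)" and BD: "B * D = 2 * z ^ 3"
    using heat robin D_def by algebra+
  \<comment> \<open>The cubic is \<open>z * D - S * (3 - z\<^sup>2)\<close>. The factor
    \<open>A\<close> allows \<open>A * D\<close> and \<open>S * A\<close> to be replaced by their
    known values, whereupon the terms cancel.\<close>
  have "A * (b * z ^ 3 + (6 + S) * z\<^sup>2 + 3 * b * z - 3 * S) = 0"
    using AD stefan D_def by algebra
  then show "b * z ^ 3 + (6 + S) * z\<^sup>2 + 3 * b * z - 3 * S = 0" using pos by simp
  show "A = 2 * z * (3 - z\<^sup>2) / (b * z\<^sup>2 + 6 * z + 3 * b)"
    "B = 2 * z ^ 3 / (b * z\<^sup>2 + 6 * z + 3 * b)"
    using AD BD D unfolding D_def by (simp_all add: field_simps)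
qed

section \<open>Square-root growth of the free boundary\<close>

text \<open>The square of \<open>s\<close> has derivative \<open>2 * q\<close> for positive times.
  Continuity at \<open>0\<close> carries the constancy of \<open>(s t)\<^sup>2 - 2 * q * t\<close>
  down to time \<open>0\<close>, where differentiability is not assumed; positivity selects the
  root.\<close>

lemma sqrt_law_of_mult_deriv_const:
  fixes s :: "real \<Rightarrow> real"
  assumes "continuous_on {0..} s" "s 0 = 0" "\<And>t. t > 0 \<Longrightarrow> 0 < s t"
    and diff: "\<And>t. t > 0 \<Longrightarrow> s differentiable (at t)"
    and const: "\<And>t. t > 0 \<Longrightarrow> s t * deriv s t = q"
    and "t \<ge> 0"
  shows "s t = sqrt (2 * q * t)"
proof (cases "t = 0")
  case False
  then have t: "t > 0" using assms by simp
  have "(s t)\<^sup>2 - 2 * q * t = (s 0)\<^sup>2 - 2 * q * 0"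
  proof (rule DERIV_isconst_end[OF t])
    show "continuous_on {0..t} (\<lambda>t. (s t)\<^sup>2 - 2 * q * t)"
      by (intro continuous_intros continuous_on_subset[OF assms(1)]) auto
    fix \<tau> assume "0 < \<tau>" "\<tau> < t"
    then have "(s has_real_derivative deriv s \<tau>) (at \<tau>)"
      using diff by (simp add: DERIV_deriv_iff_real_differentiable)
    then have "((\<lambda>t. (s t)\<^sup>2 - 2 * q * t) has_real_derivative 2 * (s \<tau> * deriv s \<tau>) - 2 * q) (at \<tau>)"
      by (auto intro!: derivative_eq_intros)
    then show "((\<lambda>t. (s t)\<^sup>2 - 2 * q * t) has_real_derivative 0) (at \<tau>)"
      using const \<open>0 < \<tau>\<close> by simp
  qed
  then have "(s t)\<^sup>2 = 2 * q * t" using assms(2) by simp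
  then show ?thesis using assms(3)[OF t] by (metis less_imp_le real_sqrt_unique)
qed (use assms in simp)

section \<open>Existence and uniqueness of the quadratic-profile solution\<close>

theorem theorem3p3:
  fixes k \<rho> c L \<Theta> h \<alpha> Ste Bi :: real
  assumes "k > 0" "\<rho> > 0" "c > 0" "L > 0" "\<Theta> > 0" "h > 0"
    and "\<alpha> = k / (\<rho> * c)"
    and "Ste = c * \<Theta> / L"
    and "Bi = h * sqrt \<alpha> / k"
  shows
    "(\<exists>!z. 0 < z \<and> z < sqrt 3 \<and>
        1 / Bi * z ^ 3 + (6 + Ste) * z\<^sup>2 + 3 / Bi * z - 3 * Ste = 0) \<and>
     (\<forall>\<xi>. 0 < \<xi> \<and> \<xi> < sqrt 3 \<and>
        1 / Bi * \<xi> ^ 3 + (6 + Ste) * \<xi>\<^sup>2 + 3 / Bi * \<xi> - 3 * Ste = 0 \<longrightarrow>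
        (let A = 2 * \<xi> * (3 - \<xi>\<^sup>2) / (1 / Bi * \<xi>\<^sup>2 + 6 * \<xi> + 3 / Bi);
             B = 2 * \<xi> ^ 3 / (1 / Bi * \<xi>\<^sup>2 + 6 * \<xi> + 3 / Bi);
             s3 = (\<lambda>t. 2 * \<xi> * sqrt (\<alpha> * t));
             T3 = quadratic_profile \<Theta> A B s3
         in 0 < A \<and> 0 < B \<and>
            P3_quadratic_solution k \<rho> c L \<Theta> h T3 s3 \<and>
            (\<forall>T s. P3_quadratic_solution k \<rho> c L \<Theta> h T s \<longrightarrow>
               (\<forall>t\<ge>0. s t = s3 t) \<and>
               (\<forall>t>0. \<forall>x\<in>{0..s3 t}. T x t = T3 x t))))"
proof -
  note k = \<open>k > 0\<close> and \<rho> = \<open>\<rho> > 0\<close> and c = \<open>c > 0\<close> and L = \<open>L > 0\<close> and \<Theta> = \<open>\<Theta> > 0\<close> and h = \<open>h > 0\<close>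
    and \<alpha>_eq = \<open>\<alpha> = k / (\<rho> * c)\<close> and Ste_eq = \<open>Ste = c * \<Theta> / L\<close> and Bi_eq = \<open>Bi = h * sqrt \<alpha> / k\<close>
  have \<alpha>: "\<alpha> > 0" and Ste: "Ste > 0" using k \<rho> c L \<Theta> by (simp_all add: \<alpha>_eq Ste_eq)
  have Bi: "Bi > 0" using h k \<alpha> by (simp add: Bi_eq)
  define b where "b = 1 / Bi"
  have b: "b > 0" and b3: "3 / Bi = 3 * b" using Bi by (simp_all add: b_def)
  \<comment> \<open>The next three equivalences strip the physical constants from the equations.
    Here \<open>r\<close> stands for \<open>s t * deriv s t\<close> divided by \<alpha>, which will
    be \<open>2 * z\<^sup>2\<close>.\<close>
  have heat_iff: "\<Theta> * (\<alpha> * r) * (A + B) / 6 = k / (\<rho> * c) * (B * \<Theta>) \<longleftrightarrow> r * (A + B) = 6 * B"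
    for r A B
  proof -
    have "\<Theta> * (\<alpha> * r) * (A + B) / 6 = \<Theta> * \<alpha> / 6 * (r * (A + B))"
      and "k / (\<rho> * c) * (B * \<Theta>) = \<Theta> * \<alpha> / 6 * (6 * B)"
      by (simp_all add: \<alpha>_eq)
    moreover have "\<Theta> * \<alpha> / 6 \<noteq> 0" using \<Theta> \<alpha> by simp
    ultimately show ?thesis by (metis mult_cancel_left)
  qed
  \<comment> \<open>With \<open>s t\<close> proportional to \<open>sqrt t\<close>, both sides carry
    the factor \<open>1 / sqrt t\<close>, so the condition no longer depends on time.\<close>
  have robin_iff: "k * ((A + 2 * B) * \<Theta> / (2 * z * sqrt (\<alpha> * t))) = h / sqrt t * (\<Theta> - (A + B) * \<Theta>)
      \<longleftrightarrow> b * (A + 2 * B) = 2 * z * (1 - A - B)" if "z > 0" "t > 0" for z t A B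
  proof -
    have "k * ((A + 2 * B) * \<Theta> / (2 * z * sqrt (\<alpha> * t))) = \<Theta> * h / (2 * z * sqrt t) * (b * (A + 2 * B))"
      using h k \<alpha> that by (simp add: b_def Bi_eq real_sqrt_mult field_simps)
    moreover have "h / sqrt t * (\<Theta> - (A + B) * \<Theta>) = \<Theta> * h / (2 * z * sqrt t) * (2 * z * (1 - A - B))"
      using that by (simp add: field_simps)
    moreover have "\<Theta> * h / (2 * z * sqrt t) \<noteq> 0"
      using \<Theta> h that by simp
    ultimately show ?thesis by (metis mult_cancel_left)
  qed
  have stefan_iff: "k * (A * \<Theta> / u) = \<rho> * L * d \<longleftrightarrow> u * d = \<alpha> * (Ste * A)" if "u > 0" for u d A
    using that \<rho> c L by (auto simp: \<alpha>_eq Ste_eq field_simps)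
  have root: "\<exists>!z. 0 < z \<and> z < sqrt 3 \<and>
      b * z ^ 3 + (6 + Ste) * z\<^sup>2 + 3 * b * z - 3 * Ste = 0"
    using b Ste by (rule ex1_root_cubic)
  have main: "0 < A \<and> 0 < B \<and> P3_quadratic_solution k \<rho> c L \<Theta> h (quadratic_profile \<Theta> A B s3) s3 \<and>
      (\<forall>T s. P3_quadratic_solution k \<rho> c L \<Theta> h T s \<longrightarrow>
         (\<forall>t\<ge>0. s t = s3 t) \<and> (\<forall>t>0. \<forall>x\<in>{0..s3 t}. T x t = quadratic_profile \<Theta> A B s3 x t))"
    if \<xi>: "0 < \<xi>" "\<xi> < sqrt 3" "b * \<xi> ^ 3 + (6 + Ste) * \<xi>\<^sup>2 + 3 * b * \<xi> - 3 * Ste = 0"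
      and A_eq: "A = 2 * \<xi> * (3 - \<xi>\<^sup>2) / (b * \<xi>\<^sup>2 + 6 * \<xi> + 3 * b)"
      and B_eq: "B = 2 * \<xi> ^ 3 / (b * \<xi>\<^sup>2 + 6 * \<xi> + 3 * b)"
      and s3_eq: "s3 = (\<lambda>t. 2 * \<xi> * sqrt (\<alpha> * t))" for \<xi> A B s3
  proof -
    note AB = quadratic_coefficients_satisfy[OF \<xi>(1,2) b Ste \<xi>(3), folded A_eq B_eq]
    have s3_pos: "0 < s3 t" if "t > 0" for t
      using that \<xi>(1) \<alpha> by (simp add: s3_eq)
    have s3_deriv: "(s3 has_real_derivative \<xi> * \<alpha> / sqrt (\<alpha> * t)) (at t)" if "t > 0" for t
      unfolding s3_eq using mult_pos_pos[OF \<alpha> that]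
      by (auto intro!: derivative_eq_intros simp: field_simps)
    have s3_diff: "s3 differentiable (at t)" if "t > 0" for t
      using s3_deriv[OF that] real_differentiable_def by blast
    have deriv_s3: "deriv s3 t = \<xi> * \<alpha> / sqrt (\<alpha> * t)" if "t > 0" for t
      using s3_deriv[OF that] by (rule DERIV_imp_deriv)
    have s3_mult_deriv: "s3 t * deriv s3 t = \<alpha> * (2 * \<xi>\<^sup>2)" if "t > 0" for t
      unfolding deriv_s3[OF that] using that \<alpha> by (simp add: s3_eq power2_eq_square)
    \<comment> \<open>Existence: the coefficient identities in \<open>AB\<close> are the three
      conditions after removal of the constants.\<close>
    have "P3_solution k \<rho> c L \<Theta> h (quadratic_profile \<Theta> A B s3) s3"
    proof (rule iffD2[OF P3_solution_quadratic_profile_iff[where \<Theta> = \<Theta> and A = A and B = B]])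
      show "s3 0 = 0 \<and>
        (\<forall>t>0. \<Theta> * (s3 t * deriv s3 t) * (A + B) / 6 = k / (\<rho> * c) * (B * \<Theta>) \<and>
             k * ((A + 2 * B) * \<Theta> / s3 t) = h / sqrt t * (\<Theta> - (A + B) * \<Theta>) \<and>
             k * (A * \<Theta> / s3 t) = \<rho> * L * deriv s3 t)"
      proof (intro conjI allI impI)
        show "s3 0 = 0" by (simp add: s3_eq)
        fix t :: real assume t: "t > 0"
        show "\<Theta> * (s3 t * deriv s3 t) * (A + B) / 6 = k / (\<rho> * c) * (B * \<Theta>)"
          unfolding s3_mult_deriv[OF t] heat_iff using AB(3) by (simp add: mult.commute)
        show "k * ((A + 2 * B) * \<Theta> / s3 t) = h / sqrt t * (\<Theta> - (A + B) * \<Theta>)"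
          using robin_iff[OF \<xi>(1) t] AB(4) by (simp add: s3_eq)
        show "k * (A * \<Theta> / s3 t) = \<rho> * L * deriv s3 t"
          using stefan_iff[OF s3_pos[OF t]] s3_mult_deriv[OF t] AB(5) by simp
      qed
    qed (simp_all add: s3_pos s3_diff)
    moreover have "continuous_on {0..} s3"
      unfolding s3_eq by (intro continuous_intros)
    moreover have "continuous_on {0<..} (deriv s3)"
      by (subst continuous_on_cong[OF refl deriv_s3]) (use \<alpha> in \<open>auto intro!: continuous_intros\<close>)
    ultimately have "P3_quadratic_solution k \<rho> c L \<Theta> h (quadratic_profile \<Theta> A B s3) s3"
      unfolding P3_quadratic_solution_def using s3_diff s3_pos AB(1,2) by blast
    moreover have "(\<forall>t\<ge>0. s t = s3 t) \<and> (\<forall>t>0. \<forall>x\<in>{0..s3 t}. T x t = quadratic_profile \<Theta> A B s3 x t)"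
      if "P3_quadratic_solution k \<rho> c L \<Theta> h T s" for T s
    proof -
      from that obtain A' B' where sol: "P3_solution k \<rho> c L \<Theta> h T s"
        and cont: "continuous_on {0..} s" and diff: "\<forall>t>0. s differentiable (at t)"
        and pos: "\<forall>t>0. 0 < s t" and AB': "0 < A'" "0 < B'"
        and T: "\<forall>t>0. \<forall>x\<in>{0..s t}. T x t = quadratic_profile \<Theta> A' B' s x t"
        unfolding P3_quadratic_solution_def by (elim exE conjE) (rule that)
      note diff = diff[rule_format] and pos = pos[rule_format] and T = T[rule_format]
      note eqs = iffD1[OF P3_solution_quadratic_profile_iff[OF pos diff T] sol]
      \<comment> \<open>The Stefan condition alone makes \<open>s t * deriv s t\<close> the constant
        \<alpha> times \<open>Ste * A'\<close>; \<open>z\<close> is chosen so that this equals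
        \<alpha> times \<open>2 * z\<^sup>2\<close>.\<close>
      define z where "z = sqrt (Ste * A' / 2)"
      have z: "z > 0" "2 * z\<^sup>2 = Ste * A'" using Ste AB' by (simp_all add: z_def)
      have mult_deriv: "s t * deriv s t = \<alpha> * (2 * z\<^sup>2)" if "t > 0" for t
        using eqs that stefan_iff[OF pos[OF that]] z(2) by metis
      have s: "s t = 2 * z * sqrt (\<alpha> * t)" if "t \<ge> 0" for t
      proof -
        have "s t = sqrt (2 * (\<alpha> * (2 * z\<^sup>2)) * t)"
          using eqs by (intro sqrt_law_of_mult_deriv_const[OF cont _ pos diff mult_deriv that]) auto
        also have "2 * (\<alpha> * (2 * z\<^sup>2)) * t = (2 * z)\<^sup>2 * (\<alpha> * t)"
          by (simp add: power2_eq_square)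
        finally show ?thesis using z(1) by (simp add: real_sqrt_mult)
      qed
      \<comment> \<open>Since \<open>z\<close>, \<open>A'\<close> and \<open>B'\<close> are
        constants, evaluation at the single time \<open>1\<close> yields the remaining
        relations.\<close>
      have "\<Theta> * (s 1 * deriv s 1) * (A' + B') / 6 = k / (\<rho> * c) * (B' * \<Theta>)"
        using eqs by simp
      then have heat: "z\<^sup>2 * (A' + B') = 3 * B'"
        unfolding mult_deriv[OF zero_less_one] heat_iff by (simp add: mult.commute)
      have "k * ((A' + 2 * B') * \<Theta> / s 1) = h / sqrt 1 * (\<Theta> - (A' + B') * \<Theta>)"
        using eqs zero_less_one by blast
      then have robin: "b * (A' + 2 * B') = 2 * z * (1 - A' - B')"
        unfolding s[OF zero_le_one] robin_iff[OF z(1) zero_less_one] .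
      note AB'' = quadratic_coefficients_unique[OF z(1) b AB' heat robin z(2)]
      \<comment> \<open>Both satisfy the cubic in the interval, where its root is unique; the
        coefficients, being functions of the root, then agree too.\<close>
      have "z = \<xi>"
        using root \<xi> z(1) AB''(1,2) by blast
      then show ?thesis
        using s T AB''(3,4) by (auto simp: s3_eq A_eq B_eq quadratic_profile_def)
    qed
    ultimately show ?thesis using AB(1,2) by blast
  qed
  show ?thesis
    unfolding b3 b_def[symmetric] Let_def
  proof (rule conjI[OF root], intro allI impI, elim conjE, goal_cases)
    case (1 \<xi>)
    then show ?case by (rule main[OF _ _ _ refl refl refl])
  qed
qed

end
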